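(* Let $A\in\mathbb{R}^{n\times n}$ and $B\in\mathbb{R}^{m\times n}$, $1\le m\le n$, both be of full rank, and consider the linear system $\dot u(t)=Au(t)$ with observable $y(t)=Bu(t)$. Let $r$ be the stabilization index of the observable Krylov spaces $\mathcal V_k$. Then there exist matrices $C_0,\dots,C_r\in\mathbb{R}^{m\times m}$ such that $$BA^{r+1}=\sum_{k=0}^{r}C_kBA^k.$$ Equivalently, with the monic matrix polynomial $Q(\lambda):=\lambda^{r+1}I_m-\sum_{k=0}^{r}C_k\lambda^k$, one has $B\,Q(A)=0$, in the sense that $BA^{r+1}-\sum_{k=0}^r C_kBA^k=0$. Consequently, for every solution $u$ of $\dot u=Au$, the observable $y=Bu$ satisfies the $(r+1)$-th order linear vector ODE $$y^{(r+1)}(t)=\sum_{k=0}^{r}C_k\,y^{(k)}(t)\qquad\text{for all } t.$$ Moreover, $r+1\le n$, and $r+1$ is minimal with this property: it is the smallest integer $s\ge 1$ for which there exist matrices $C_0,\dots,C_{s-1}\in\mathbb{R}^{m\times m}$ with $BA^{s}=\sum_{k=0}^{s-1}C_kBA^k$ (equivalently, such that all observables satisfy $y^{(s)}=\sum_{k=0}^{s-1}C_ky^{(k)}$).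
   Context: The observable Krylov spaces are $\mathcal V_k=\mathrm{range}[B^\top,A^\top B^\top,\dots,(A^\top)^kB^\top]=\mathrm{span}\{(A^\top)^jB^\top v: j=0,\dots,k,\ v\in\mathbb{R}^m\}\subseteq\mathbb{R}^n$ for $k\ge 0$, with the convention $\dim\mathcal V_{-1}=0$. The stabilization index $r\ge 0$ is the index with $\dim\mathcal V_{r-1}<\dim\mathcal V_r=\dim\mathcal V_{r+1}\le n$; it satisfies $r\le n-1$. *)

theory Defs
  imports "HOL-Analysis.Analysis" "HOL-Computational_Algebra.Polynomial"
begin

(* The operator ^ on the type of square matrices is the componentwise power, hence an own
   definition of the power with respect to the matrix product. *)
primrec matpow :: "real^'n^'n \<Rightarrow> nat \<Rightarrow> real^'n^'n" where
  "matpow A 0 = mat 1"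
| "matpow A (Suc k) = A ** matpow A k"

definition krylov :: "real^'n^'n \<Rightarrow> real^'n^'m \<Rightarrow> nat \<Rightarrow> (real^'n) set" where
  "krylov A B k =
     span {matpow (transpose A) j *v (transpose B *v v) | j v. j \<le> k}"

(* The index is an integer because of the convention that the space of index -1 has
   dimension 0. *)
definition krylov_dim :: "real^'n^'n \<Rightarrow> real^'n^'m \<Rightarrow> int \<Rightarrow> nat" where
  "krylov_dim A B k = (if k < 0 then 0 else dim (krylov A B (nat k)))"

(* If B is nonzero, exactly one r satisfies the condition. *)
definition stabilization_index :: "real^'n^'n \<Rightarrow> real^'n^'m \<Rightarrow> nat" where
  "stabilization_index A B = (THE r.
     krylov_dim A B (int r - 1) < krylov_dim A B (int r) \<and>
     krylov_dim A B (int r) = krylov_dim A B (int r + 1) \<and>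
     krylov_dim A B (int r + 1) \<le> CARD('n))"

definition monic_matpoly :: "nat \<Rightarrow> (nat \<Rightarrow> real^'m^'m) \<Rightarrow> (real^'m^'m) poly" where
  "monic_matpoly s C = monom (mat 1) s - (\<Sum>k<s. monom (C k) k)"

(* "B Q(A)" for an m x m matrix polynomial Q and an m x n matrix B: the coefficients of Q act
   on B from the left, the powers of A from the right. *)
definition matpoly_apply ::
  "real^'n^'m \<Rightarrow> (real^'m^'m) poly \<Rightarrow> real^'n^'n \<Rightarrow> real^'n^'m" where
  "matpoly_apply B Q A = (\<Sum>k\<le>degree Q. coeff Q k ** B ** matpow A k)"

definition solves_linear_ode :: "real^'n^'n \<Rightarrow> (real \<Rightarrow> real^'n) \<Rightarrow> bool" where
  "solves_linear_ode A u \<longleftrightarrow> (\<forall>t. (u has_vector_derivative A *v u t) (at t))"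

definition vderiv :: "nat \<Rightarrow> (real \<Rightarrow> 'a::real_normed_vector) \<Rightarrow> real \<Rightarrow> 'a" where
  "vderiv k y = ((\<lambda>g t. vector_derivative g (at t)) ^^ k) y"

(* The first conjunct says that y is s times differentiable, so that the derivatives in the
   second one, given by a total function, are meaningful. *)
definition satisfies_vector_ode ::
  "nat \<Rightarrow> (nat \<Rightarrow> real^'m^'m) \<Rightarrow> (real \<Rightarrow> real^'m) \<Rightarrow> bool" where
  "satisfies_vector_ode s C y \<longleftrightarrow>
     (\<forall>j<s. \<forall>t. vderiv j y differentiable (at t)) \<and>
     (\<forall>t. vderiv s y t = (\<Sum>k<s. C k *v vderiv k y t))"

end

theory Submission
  imports Defs
begin

text \<open>
  Since \<open>(A\<^sup>T)\<^sup>j B\<^sup>T v\<close> is the row vector \<open>v\<^sup>T B A\<^sup>j\<close>, the space of index \<open>k\<close> is spanned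
  by the rows of \<open>B, B A, \<dots>, B A\<^sup>k\<close>. Multiplying \<open>B A\<^sup>j\<close> from the left by a matrix \<open>C\<^sub>j\<close> forms
  arbitrary combinations of its rows. Hence a relation \<open>B A\<^sup>s = \<Sum>j<s. C\<^sub>j B A\<^sup>j\<close> exists if and
  only if the rows of \<open>B A\<^sup>s\<close> lie in the space of index \<open>s - 1\<close>, that is, if and only if the
  spaces of index \<open>s - 1\<close> and \<open>s\<close> coincide (lemma \<open>matrix_relation_iff_krylov_stable\<close>).

  Multiplication by \<open>A\<close> from the right maps each space into the next one, so once two consecutive
  spaces coincide the sequence is constant. The stabilization index is therefore the first \<open>r\<close>
  for which the spaces of index \<open>r\<close> and \<open>r + 1\<close> coincide, which gives both the existence of the
  relation for \<open>s = r + 1\<close> and its minimality. The dimensions increase strictly from a positive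
  value up to index \<open>r\<close> and cannot exceed \<open>n\<close>, whence \<open>r < n\<close> (lemma \<open>stabilization_index\<close>).

  Along a solution of \<open>u' = A u\<close> the observable \<open>y = B u\<close> has the derivatives
  \<open>y\<^sup>(\<^sup>j\<^sup>) = B A\<^sup>j u\<close>, so the vector differential equation is the matrix relation applied to \<open>u(t)\<close>.
  Required of all solutions, it implies the matrix relation because, by the exponential series, a solution can take any
  prescribed value at \<open>0\<close> (lemma \<open>matrix_relation_iff_ode\<close>).
\<close>

section \<open>Matrix algebra\<close>

text \<open>
  The row blocks \<open>B A\<^sup>k\<close> grow by factors on the right, whereas the recursion equation adds a factor
  on the left; as a rewrite rule it would break these blocks up.
\<close>
declare matpow.simps(2) [simp del]

lemma matpow_Suc_right: "matpow A (Suc k) = matpow A k ** A"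
  by (induction k) (simp_all add: matpow.simps(2) matrix_mul_assoc)

lemma transpose_matpow: "transpose (matpow A k) = matpow (transpose A) k"
proof (induction k)
  case 0
  show ?case by (simp add: transpose_mat)
next
  case (Suc k)
  show ?case
    by (simp add: matrix_transpose_mul Suc matpow.simps(2)[of A k]
        matpow_Suc_right[of "transpose A" k])
qed

lemma linear_vector_matrix_mult: "linear (\<lambda>x. x v* (M :: real^'n^'m))"
  using matrix_vector_mul_linear[of "transpose M"] by simp

lemma vector_matrix_mult_sum_right:
  "x v* sum f S = (\<Sum>k\<in>S. x v* (f k :: real^'n^'m))"
  by (induction S rule: infinite_finite_induct) (simp_all add: vector_matrix_mult_add_rdistrib)

lemma matrix_vector_mult_sum_left:
  "sum f S *v x = (\<Sum>k\<in>S. (f k :: real^'n^'m) *v x)"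
  by (induction S rule: infinite_finite_induct) (simp_all add: matrix_vector_mult_add_rdistrib)

lemma axis_vector_matrix_mult: "axis i 1 v* M = (M :: real^'n^'m) $ i"
  by (simp add: vec_eq_iff vector_matrix_mult_def axis_def if_distrib if_distribR sum.delta cong: if_cong)

lemma uminus_matrix_mult: "(- M) ** N = - (M ** (N :: real^'n^'m))"
  by (simp add: vec_eq_iff matrix_matrix_mult_def sum_negf)

section \<open>Krylov spaces as row spaces\<close>

text \<open>Row vectors avoid transposes and make left multiplication by coefficient matrices visible.\<close>
lemma krylov_eq_span_rows:
  "krylov A B k = span {v v* (B ** matpow A j) | j v. j \<le> k}"
proof -
  have "matpow (transpose A) j *v (transpose B *v v) = v v* (B ** matpow A j)" for j v
  proof -
    have "matpow (transpose A) j *v (transpose B *v v) = transpose (B ** matpow A j) *v v"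
      by (simp add: matrix_transpose_mul transpose_matpow matrix_vector_mul_assoc
          del: transpose_matrix_vector)
    then show ?thesis by simp
  qed
  then show ?thesis by (simp add: krylov_def)
qed

lemma krylov_mono: "j \<le> k \<Longrightarrow> krylov A B j \<subseteq> krylov A B k"
  unfolding krylov_eq_span_rows by (rule span_mono) (auto intro: le_trans)

lemma rows_in_krylov: "j \<le> k \<Longrightarrow> v v* (B ** matpow A j) \<in> krylov A B k"
  unfolding krylov_eq_span_rows by (rule span_base) blast

text \<open>
  One coefficient vector per power of \<open>A\<close> suffices, because the vectors \<open>v\<close> that occur with the
  same power can be added. These coefficient vectors become the rows of the matrices \<open>C\<^sub>j\<close>.
\<close>
lemma krylov_eq_range:
  fixes A :: "real^'n^'n" and B :: "real^'n^'m"
  shows "krylov A B k = range (\<lambda>w. \<Sum>j\<le>k. w j v* (B ** matpow A j))"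
    (is "_ = range ?g")
proof
  have "subspace (range ?g)"
    unfolding subspace_def
  proof (intro conjI ballI allI)
    show "0 \<in> range ?g"
      by (rule range_eqI[of _ _ "\<lambda>_. 0"]) simp
  next
    fix x y assume "x \<in> range ?g" "y \<in> range ?g"
    then obtain w w' where "x = ?g w" "y = ?g w'" by blast
    then have "x + y = ?g (\<lambda>j. w j + w' j)"
      by (simp add: linear_add[OF linear_vector_matrix_mult] sum.distrib)
    then show "x + y \<in> range ?g" by (intro range_eqI)
  next
    fix c x assume "x \<in> range ?g"
    then obtain w where "x = ?g w" by blast
    then have "c *\<^sub>R x = ?g (\<lambda>j. c *\<^sub>R w j)"
      by (simp only: linear_scale[OF linear_vector_matrix_mult] scaleR_sum_right)
    then show "c *\<^sub>R x \<in> range ?g" by (intro range_eqI)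
  qed
  moreover have "{v v* (B ** matpow A j) | j v. j \<le> k} \<subseteq> range ?g"
  proof clarify
    fix j v assume "j \<le> k"
    then have "v v* (B ** matpow A j) = ?g (\<lambda>i. if i = j then v else 0)"
      by (simp add: if_distribR if_distrib[of "\<lambda>x. x v* _"] sum.delta cong: if_cong)
    then show "v v* (B ** matpow A j) \<in> range ?g" by (intro range_eqI)
  qed
  ultimately show "krylov A B k \<subseteq> range ?g"
    unfolding krylov_eq_span_rows by (rule span_minimal[rotated])
  show "range ?g \<subseteq> krylov A B k"
    by (clarify, intro subspace_sum rows_in_krylov) (simp_all add: krylov_def)
qed

lemma krylov_Suc_eq_iff:
  "krylov A B (Suc k) = krylov A B k \<longleftrightarrow> (\<forall>v. v v* (B ** matpow A (Suc k)) \<in> krylov A B k)"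
    (is "?L \<longleftrightarrow> ?R")
proof
  assume ?L
  then show ?R using rows_in_krylov[of "Suc k" "Suc k" _ B A] by auto
next
  assume R: ?R
  have "krylov A B (Suc k) \<subseteq> krylov A B k"
    unfolding krylov_eq_span_rows[of A B "Suc k"]
  proof (rule span_minimal)
    show "{v v* (B ** matpow A j) |j v. j \<le> Suc k} \<subseteq> krylov A B k"
      using R rows_in_krylov by (fastforce simp: le_Suc_eq)
    show "subspace (krylov A B k)" by (simp add: krylov_def)
  qed
  then show ?L using krylov_mono[of k "Suc k" A B] by auto
qed

text \<open>
  The membership of the rows of the next block in the span of the previous ones can be read off
  from the matrix relation and conversely: row \<open>i\<close> of \<open>C\<^sub>j\<close> collects the coefficients with which
  the rows of \<open>B A\<^sup>j\<close> enter row \<open>i\<close> of the new block.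
\<close>
lemma matrix_relation_iff_krylov_stable:
  fixes A :: "real^'n^'n" and B :: "real^'n^'m"
  shows "(\<exists>C :: nat \<Rightarrow> real^'m^'m. B ** matpow A (Suc k) = (\<Sum>j\<le>k. C j ** B ** matpow A j))
    \<longleftrightarrow> krylov A B (Suc k) = krylov A B k"
  unfolding krylov_Suc_eq_iff
proof
  assume "\<exists>C :: nat \<Rightarrow> real^'m^'m. B ** matpow A (Suc k) = (\<Sum>j\<le>k. C j ** B ** matpow A j)"
  then obtain C :: "nat \<Rightarrow> real^'m^'m"
    where "B ** matpow A (Suc k) = (\<Sum>j\<le>k. C j ** B ** matpow A j)" by blast
  then have "v v* (B ** matpow A (Suc k)) = (\<Sum>j\<le>k. (v v* C j) v* (B ** matpow A j))" for v
    by (simp add: vector_matrix_mult_sum_right vector_matrix_mul_assoc matrix_mul_assoc)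
  then show "\<forall>v. v v* (B ** matpow A (Suc k)) \<in> krylov A B k"
    by (auto simp: krylov_eq_range)
next
  assume "\<forall>v. v v* (B ** matpow A (Suc k)) \<in> krylov A B k"
  then have "\<forall>i. \<exists>w. axis i 1 v* (B ** matpow A (Suc k)) = (\<Sum>j\<le>k. w j v* (B ** matpow A j))"
    by (auto simp: krylov_eq_range)
  then obtain w where w: "\<And>i. axis i 1 v* (B ** matpow A (Suc k))
      = (\<Sum>j\<le>k. w i j v* (B ** matpow A j))" by metis
  define C where "C j = (\<chi> i. w i j)" for j
  have "axis i 1 v* (\<Sum>j\<le>k. C j ** B ** matpow A j) = axis i 1 v* (B ** matpow A (Suc k))" for i
  proof -
    have "axis i 1 v* (C j ** B ** matpow A j) = w i j v* (B ** matpow A j)" for j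
      by (simp add: matrix_mul_assoc[symmetric] vector_matrix_mul_assoc[symmetric]
            axis_vector_matrix_mult C_def)
    then show ?thesis by (simp add: vector_matrix_mult_sum_right w)
  qed
  then have "B ** matpow A (Suc k) = (\<Sum>j\<le>k. C j ** B ** matpow A j)"
    unfolding axis_vector_matrix_mult by (simp add: vec_eq_iff)
  then show "\<exists>C :: nat \<Rightarrow> real^'m^'m. B ** matpow A (Suc k) = (\<Sum>j\<le>k. C j ** B ** matpow A j)"
    by blast
qed

section \<open>Stabilization\<close>

text \<open>
  Right multiplication by \<open>A\<close> turns a combination of the rows of \<open>B, \<dots>, B A\<^sup>k\<close> into one of the
  rows of \<open>B A, \<dots>, B A\<^bsup>k+1\<^esup>\<close>.
\<close>
lemma krylov_stable_Suc:
  fixes A :: "real^'n^'n" and B :: "real^'n^'m"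
  assumes "krylov A B (Suc k) = krylov A B k"
  shows "krylov A B (Suc (Suc k)) = krylov A B (Suc k)"
  unfolding krylov_Suc_eq_iff
proof
  fix v
  have "v v* (B ** matpow A (Suc k)) \<in> krylov A B k"
    using assms unfolding krylov_Suc_eq_iff by blast
  then obtain w where w: "v v* (B ** matpow A (Suc k)) = (\<Sum>j\<le>k. w j v* (B ** matpow A j))"
    by (auto simp: krylov_eq_range)
  have "v v* (B ** matpow A (Suc (Suc k))) = (v v* (B ** matpow A (Suc k))) v* A"
    by (simp add: matpow_Suc_right vector_matrix_mul_assoc matrix_mul_assoc)
  also have "\<dots> = (\<Sum>j\<le>k. w j v* (B ** matpow A (Suc j)))"
    unfolding w linear_sum[OF linear_vector_matrix_mult]
    by (simp add: matpow_Suc_right vector_matrix_mul_assoc matrix_mul_assoc)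
  also have "\<dots> \<in> krylov A B (Suc k)"
    by (intro subspace_sum rows_in_krylov) (simp_all add: krylov_def)
  finally show "v v* (B ** matpow A (Suc (Suc k))) \<in> krylov A B (Suc k)" .
qed

lemma krylov_stable_le:
  assumes "krylov A B (Suc k) = krylov A B k" and "k \<le> j"
  shows "krylov A B (Suc j) = krylov A B j"
  using assms(2)
  by (induction j rule: dec_induct) (simp_all only: assms(1) krylov_stable_Suc)

lemma dim_krylov_le: "dim (krylov A (B :: real^'n^'m) k) \<le> CARD('n)"
  using dim_subset_UNIV[of "krylov A B k"] by simp

lemma krylov_Suc_dim_eq_iff:
  "dim (krylov A B (Suc k)) = dim (krylov A B k) \<longleftrightarrow> krylov A B (Suc k) = krylov A B k"
proof
  assume "dim (krylov A B (Suc k)) = dim (krylov A B k)"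
  moreover have "subspace (krylov A B j)" for j
    by (simp add: krylov_def)
  ultimately show "krylov A B (Suc k) = krylov A B k"
    by (intro subspace_dim_equal[symmetric] krylov_mono) simp_all
qed simp

text \<open>The first space has positive dimension, and each strict inclusion adds at least one.\<close>
lemma dim_krylov_gt:
  fixes A :: "real^'n^'n" and B :: "real^'n^'m"
  assumes "B \<noteq> 0" and "\<And>j. j < k \<Longrightarrow> krylov A B (Suc j) \<noteq> krylov A B j"
  shows "k < dim (krylov A B k)"
  using assms(2)
proof (induction k)
  case 0
  obtain i where "B $ i \<noteq> 0" using \<open>B \<noteq> 0\<close> by (auto simp: vec_eq_iff)
  moreover have "B $ i \<in> krylov A B 0"
    using rows_in_krylov[of 0 0 "axis i 1" B A] by (simp add: axis_vector_matrix_mult)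
  ultimately have "\<not> krylov A B 0 \<subseteq> {0}" by auto
  then show ?case by (simp add: zero_less_iff_neq_zero)
next
  case (Suc k)
  have "dim (krylov A B k) \<le> dim (krylov A B (Suc k))"
    by (intro dim_subset krylov_mono) simp
  moreover have "dim (krylov A B (Suc k)) \<noteq> dim (krylov A B k)"
    unfolding krylov_Suc_dim_eq_iff by (rule Suc.prems) simp
  moreover have "k < dim (krylov A B k)"
    by (rule Suc.IH, rule Suc.prems) simp
  ultimately show ?case by linarith
qed

text \<open>
  The strict inequality of dimensions in the definition says, given stability at \<open>r\<close>, that no
  earlier index is stable, since stability propagates upwards; for \<open>r = 0\<close> it is the positivity of
  the first dimension. So the definite description denotes the least stable index, which exists
  because dimensions are bounded.
\<close>
lemma stabilization_index:
  fixes A :: "real^'n^'n" and B :: "real^'n^'m"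
  assumes "B \<noteq> 0"
  defines "r \<equiv> stabilization_index A B"
  shows krylov_stabilization_index: "krylov A B (Suc r) = krylov A B r"
    and stabilization_index_le: "krylov A B (Suc k) = krylov A B k \<Longrightarrow> r \<le> k"
    and stabilization_index_less: "r < CARD('n)"
proof -
  let ?S = "\<lambda>k. krylov A B (Suc k) = krylov A B k"
  have ex: "\<exists>k. ?S k"
  proof (rule ccontr)
    assume "\<nexists>k. ?S k"
    then have "krylov A B (Suc j) \<noteq> krylov A B j" for j
      by blast
    then have "CARD('n) < dim (krylov A B CARD('n))"
      by (rule dim_krylov_gt[OF \<open>B \<noteq> 0\<close>])
    moreover have "dim (krylov A B CARD('n)) \<le> CARD('n)"
      by (rule dim_krylov_le)
    ultimately show False by linarith
  qed
  define l where "l = (LEAST k. ?S k)"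
  have l: "?S l"
    unfolding l_def using ex by (rule LeastI_ex)
  have l_le: "l \<le> k" if "?S k" for k
    unfolding l_def using that by (rule Least_le)
  have l_less: "l < dim (krylov A B l)"
    by (intro dim_krylov_gt[OF \<open>B \<noteq> 0\<close>]) (use l_le leD in blast)
  have dims: "krylov_dim A B (int k) = dim (krylov A B k)" 
     "krylov_dim A B (int k + 1) = dim (krylov A B (Suc k))" for k
    by (simp_all add: krylov_dim_def nat_add_distrib)
  have prev: "krylov_dim A B (int k - 1) < krylov_dim A B (int k) \<longleftrightarrow> (\<forall>j<k. \<not> ?S j)"
    if "?S k" for k
  proof (cases k)
    case 0
    have "0 < dim (krylov A B 0)" by (rule dim_krylov_gt[OF \<open>B \<noteq> 0\<close>]) simp
    then show ?thesis by (simp add: 0 krylov_dim_def)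
  next
    case (Suc i)
    have "dim (krylov A B i) \<le> dim (krylov A B k)"
      by (intro dim_subset krylov_mono) (simp add: Suc)
    moreover have "krylov_dim A B (int k - 1) = dim (krylov A B i)"
      using dims(1)[of i] by (simp add: Suc)
    moreover have "krylov_dim A B (int k) = dim (krylov A B (Suc i))"
      unfolding dims Suc ..
    ultimately have "krylov_dim A B (int k - 1) < krylov_dim A B (int k) \<longleftrightarrow> \<not> ?S i"
      using krylov_Suc_dim_eq_iff[of A B i]
      by (simp add: Suc less_le eq_commute[of "dim (krylov A B i)"])
    \<comment> \<open>Stability at an earlier index would propagate to \<open>i\<close>.\<close>
    also have "\<dots> \<longleftrightarrow> (\<forall>j<k. \<not> ?S j)"
      using krylov_stable_le[of A B _ i] by (auto simp: Suc less_Suc_eq_le)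
    finally show ?thesis .
  qed
  have "r = l"
    unfolding r_def stabilization_index_def
  proof (rule the_equality, goal_cases)
    case 1
    show ?case
      using prev[OF l] l l_le dim_krylov_le[of A B "Suc l"] by (auto simp: dims not_le[symmetric])
  next
    case (2 k)
    then have "?S k" using krylov_Suc_dim_eq_iff[of A B k] by (simp add: dims)
    with 2 prev have "\<forall>j<k. \<not> ?S j" by blast
    with \<open>?S k\<close> l l_le show ?case by (metis le_less)
  qed
  then show "?S r" "?S k \<Longrightarrow> r \<le> k" "r < CARD('n)"
    using l l_le l_less dim_krylov_le[of A B l] by auto
qed

section \<open>Monic matrix polynomials\<close>

lemma coeff_monic_matpoly:
  "coeff (monic_matpoly s C) k = (if k = s then mat 1 else if k < s then - C k else 0)"
  by (auto simp: monic_matpoly_def coeff_sum sum.delta)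

lemma mat_1_neq_0: "mat 1 \<noteq> (0 :: real^'m^'m)"
  by (simp add: vec_eq_iff mat_def)

lemma degree_monic_matpoly: "degree (monic_matpoly s (C :: nat \<Rightarrow> real^'m^'m)) = s"
  by (rule antisym[OF degree_le le_degree]) (auto simp: coeff_monic_matpoly mat_1_neq_0)

lemma matpoly_apply_monic:
  "matpoly_apply B (monic_matpoly s C) A = B ** matpow A s - (\<Sum>k<s. C k ** B ** matpow A k)"
proof -
  have "matpoly_apply B (monic_matpoly s C) A
      = B ** matpow A s + (\<Sum>k<s. (- C k) ** B ** matpow A k)"
    by (simp add: matpoly_apply_def degree_monic_matpoly lessThan_Suc_atMost[symmetric]
        coeff_monic_matpoly)
  then show ?thesis by (simp add: uminus_matrix_mult sum_negf)
qed

section \<open>Linear differential equations\<close>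

lemma norm_matpow_vector_le:
  fixes A :: "real^'n^'n"
  shows "norm (matpow A k *v v) \<le> onorm ((*v) A) ^ k * norm v"
proof (induction k)
  case (Suc k)
  have "norm (matpow A (Suc k) *v v) \<le> onorm ((*v) A) * norm (matpow A k *v v)"
    using onorm[of "(*v) A" "matpow A k *v v"]
    by (simp add: matrix_vector_mul_assoc matpow.simps(2))
  also have "\<dots> \<le> onorm ((*v) A) * (onorm ((*v) A) ^ k * norm v)"
    by (intro mult_left_mono Suc onorm_pos_le) simp
  finally show ?case by simp
qed simp

text \<open>
  The solution is \<open>exp (t A) v\<close>, written as one real power series per coordinate so that termwise
  differentiation of scalar power series applies.
\<close>
lemma linear_ode_solution_exists:
  fixes A :: "real^'n^'n"
  obtains u where "solves_linear_ode A u" "u 0 = v"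
proof -
  define c where "c i k = (matpow A k *v v) $ i / fact k" for i k
  define u where "u t = (\<chi> i. \<Sum>k. c i k * t ^ k)" for t :: real
  have summable: "summable (\<lambda>k. c i k * t ^ k)" for i t
  proof (rule summable_comparison_test')
    let ?K = "onorm ((*v) A) * \<bar>t\<bar>"
    show "summable (\<lambda>k. norm v * (inverse (fact k) * ?K ^ k))"
      by (intro summable_mult summable_exp)
    show "norm (c i k * t ^ k) \<le> norm v * (inverse (fact k) * ?K ^ k)" if "k \<ge> 0" for k
    proof -
      have "\<bar>(matpow A k *v v) $ i\<bar> \<le> onorm ((*v) A) ^ k * norm v"
        using component_le_norm_cart norm_matpow_vector_le by (rule order_trans)
      then have "\<bar>(matpow A k *v v) $ i\<bar> * (inverse (fact k) * \<bar>t\<bar> ^ k)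
          \<le> onorm ((*v) A) ^ k * norm v * (inverse (fact k) * \<bar>t\<bar> ^ k)"
        by (rule mult_right_mono) simp
      then show ?thesis
        by (simp add: c_def abs_mult power_abs power_mult_distrib field_simps)
    qed
  qed
  \<comment> \<open>The coefficients of the derived series are those of \<open>A *v u t\<close>.\<close>
  have diffs: "diffs (c i) k = (\<Sum>j\<in>UNIV. A $ i $ j * c j k)" for i k
  proof -
    have "diffs (c i) k = (A *v (matpow A k *v v)) $ i / fact k"
      by (simp add: diffs_def c_def matrix_vector_mul_assoc matpow.simps(2))
    then show ?thesis by (simp add: matrix_vector_mult_def[of A] c_def sum_divide_distrib)
  qed
  have "((\<lambda>t. u t $ i) has_field_derivative (A *v u t) $ i) (at t)" for i t
  proof -
    have "((\<lambda>t. u t $ i) has_field_derivative (\<Sum>k. diffs (c i) k * t ^ k)) (at t)"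
      unfolding u_def vec_lambda_beta by (rule termdiffs_strong_converges_everywhere[OF summable])
    moreover have "(\<Sum>k. diffs (c i) k * t ^ k) = (\<Sum>j\<in>UNIV. \<Sum>k. A $ i $ j * (c j k * t ^ k))"
      unfolding diffs sum_distrib_right mult.assoc by (intro suminf_sum summable_mult summable)
    moreover have "\<dots> = (A *v u t) $ i"
      by (simp add: matrix_vector_mult_def u_def suminf_mult[OF summable])
    ultimately show ?thesis by simp
  qed
  then have "solves_linear_ode A u"
    unfolding solves_linear_ode_def has_vector_derivative_def has_derivative_componentwise_within[of u]
    by (auto simp: Basis_vec_def inner_axis has_field_derivative_def mult_commute_abs)
  moreover have "u 0 = v"
    unfolding u_def powser_zero by (simp add: c_def vec_eq_iff)
  ultimately show ?thesis by (rule that)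
qed

lemma has_vector_derivative_observable:
  fixes M :: "real^'n^'m"
  assumes "solves_linear_ode A u"
  shows "((\<lambda>t. M *v u t) has_vector_derivative (M ** A) *v u t) (at t)"
  using bounded_linear.has_vector_derivative[OF matrix_vector_mul_bounded_linear[of M]] assms
  unfolding solves_linear_ode_def by (fastforce simp: matrix_vector_mul_assoc)

lemma vderiv_observable:
  assumes "solves_linear_ode A u"
  shows "vderiv k (\<lambda>t. B *v u t) = (\<lambda>t. (B ** matpow A k) *v u t)"
proof (induction k)
  case (Suc k)
  have "vderiv (Suc k) (\<lambda>t. B *v u t)
      = (\<lambda>t. vector_derivative (\<lambda>t. (B ** matpow A k) *v u t) (at t))"
    using Suc by (simp add: vderiv_def)
  also have "\<dots> = (\<lambda>t. (B ** matpow A (Suc k)) *v u t)"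
    using has_vector_derivative_observable[OF assms]
    by (auto simp: matpow_Suc_right matrix_mul_assoc intro!: vector_derivative_at)
  finally show ?case .
qed (simp add: vderiv_def)

lemma observable_ode_iff:
  assumes "solves_linear_ode A u"
  shows "satisfies_vector_ode s C (\<lambda>t. B *v u t) \<longleftrightarrow>
    (\<forall>t. (B ** matpow A s) *v u t = (\<Sum>k<s. C k ** B ** matpow A k) *v u t)"
proof -
  have "(\<lambda>t. (B ** matpow A j) *v u t) differentiable at t" for j t
    using has_vector_derivative_observable[OF assms] by (rule differentiableI_vector)
  then show ?thesis
    by (simp add: satisfies_vector_ode_def vderiv_observable[OF assms] matrix_vector_mult_sum_left
        matrix_vector_mul_assoc matrix_mul_assoc)
qed

text \<open>
  Evaluated at time \<open>0\<close> on solutions with all possible initial values, the differential equation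
  says that two matrices agree on every vector.
\<close>
lemma matrix_relation_iff_ode:
  "B ** matpow A s = (\<Sum>k<s. C k ** B ** matpow A k) \<longleftrightarrow>
    (\<forall>u. solves_linear_ode A u \<longrightarrow> satisfies_vector_ode s C (\<lambda>t. B *v u t))"
proof
  assume "B ** matpow A s = (\<Sum>k<s. C k ** B ** matpow A k)"
  then show "\<forall>u. solves_linear_ode A u \<longrightarrow> satisfies_vector_ode s C (\<lambda>t. B *v u t)"
    by (simp add: observable_ode_iff)
next
  assume ode: "\<forall>u. solves_linear_ode A u \<longrightarrow> satisfies_vector_ode s C (\<lambda>t. B *v u t)"
  show "B ** matpow A s = (\<Sum>k<s. C k ** B ** matpow A k)"
    unfolding matrix_eq
  proof
    fix v
    obtain u where u: "solves_linear_ode A u" "u 0 = v" by (rule linear_ode_solution_exists)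
    have "satisfies_vector_ode s C (\<lambda>t. B *v u t)"
      using ode u(1) by blast
    then show "(B ** matpow A s) *v v = (\<Sum>k<s. C k ** B ** matpow A k) *v v"
      unfolding observable_ode_iff[OF u(1)] using u(2) by auto
  qed
qed

theorem theorem3p2:
  fixes A :: "real^'n^'n" and B :: "real^'n^'m" and r :: nat
  assumes "CARD('m) \<le> CARD('n)"
    and "rank A = CARD('n)" and "rank B = CARD('m)"
    and "r = stabilization_index A B"
  shows
    "(\<exists>C :: nat \<Rightarrow> real^'m^'m.
        B ** matpow A (r + 1) = (\<Sum>k\<le>r. C k ** B ** matpow A k) \<and>
        matpoly_apply B (monic_matpoly (r + 1) C) A = 0 \<and>
        (\<forall>u. solves_linear_ode A u \<longrightarrow> satisfies_vector_ode (r + 1) C (\<lambda>t. B *v u t))) \<and>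
     (\<forall>(s::nat) (C :: nat \<Rightarrow> real^'m^'m).
        degree (monic_matpoly s C) = s \<and> lead_coeff (monic_matpoly s C) = mat 1 \<and>
        (B ** matpow A s = (\<Sum>k<s. C k ** B ** matpow A k) \<longleftrightarrow>
           matpoly_apply B (monic_matpoly s C) A = 0)) \<and>
     (\<forall>(s::nat) (C :: nat \<Rightarrow> real^'m^'m). 1 \<le> s \<longrightarrow>
        (B ** matpow A s = (\<Sum>k<s. C k ** B ** matpow A k) \<longleftrightarrow>
           (\<forall>u. solves_linear_ode A u \<longrightarrow> satisfies_vector_ode s C (\<lambda>t. B *v u t)))) \<and>
     r + 1 \<le> CARD('n) \<and>
     (\<forall>s::nat. 1 \<le> s \<and>
        (\<exists>C :: nat \<Rightarrow> real^'m^'m. B ** matpow A s = (\<Sum>k<s. C k ** B ** matpow A k)) \<longrightarrow>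
        r + 1 \<le> s) \<and>
     (\<forall>s::nat. 1 \<le> s \<and>
        (\<exists>C :: nat \<Rightarrow> real^'m^'m. \<forall>u. solves_linear_ode A u \<longrightarrow>
           satisfies_vector_ode s C (\<lambda>t. B *v u t)) \<longrightarrow>
        r + 1 \<le> s)"
proof -
  have "B \<noteq> 0"
  proof
    assume "B = 0"
    then have "rank B = 0" by (auto simp: row_rank_def rows_def row_def dim_eq_0 vec_eq_iff)
    then show False using assms(3) by simp
  qed
  note r = stabilization_index[OF \<open>B \<noteq> 0\<close>, of A, folded assms(4)]
  have apply_iff: "B ** matpow A s = (\<Sum>k<s. C k ** B ** matpow A k) \<longleftrightarrow>
      matpoly_apply B (monic_matpoly s C) A = 0" for s and C :: "nat \<Rightarrow> real^'m^'m"
    by (simp add: matpoly_apply_monic)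
  obtain C :: "nat \<Rightarrow> real^'m^'m"
    where C: "B ** matpow A (r + 1) = (\<Sum>k\<le>r. C k ** B ** matpow A k)"
    using r(1) matrix_relation_iff_krylov_stable[of B A r] by auto
  have C': "B ** matpow A (r + 1) = (\<Sum>k<r + 1. C k ** B ** matpow A k)"
    using C by (simp only: Suc_eq_plus1[symmetric] lessThan_Suc_atMost)
  have minimal: "r + 1 \<le> s"
    if "1 \<le> s" and "B ** matpow A s = (\<Sum>k<s. C k ** B ** matpow A k)"
    for s and C :: "nat \<Rightarrow> real^'m^'m"
  proof -
    obtain k where s: "s = Suc k" using \<open>1 \<le> s\<close> by (cases s) auto
    have "krylov A B (Suc k) = krylov A B k"
      using that(2) unfolding s lessThan_Suc_atMost
      by (intro matrix_relation_iff_krylov_stable[THEN iffD1]) blast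
    then show ?thesis using r(2) s by simp
  qed
  show ?thesis
  proof (intro conjI)
    show "\<exists>C :: nat \<Rightarrow> real^'m^'m.
        B ** matpow A (r + 1) = (\<Sum>k\<le>r. C k ** B ** matpow A k) \<and>
        matpoly_apply B (monic_matpoly (r + 1) C) A = 0 \<and>
        (\<forall>u. solves_linear_ode A u \<longrightarrow> satisfies_vector_ode (r + 1) C (\<lambda>t. B *v u t))"
      using C C' apply_iff matrix_relation_iff_ode by blast
    show "r + 1 \<le> CARD('n)" using r(3) by simp
  qed (use minimal matrix_relation_iff_ode[of B A] in
      \<open>auto simp: apply_iff degree_monic_matpoly coeff_monic_matpoly\<close>)
qed

end
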